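(* For every Euclidean zero-set $\widetilde{\mathcal Z}$ with finite area and every $(\alpha,\beta)\in[0,1]^2$, $$\widetilde I(\alpha,\beta,\widetilde{\mathcal Z})\ge(1-\max(\alpha,\beta))\,\widetilde\gamma(\widetilde{\mathcal Z})$$ and $$\widetilde I(\alpha,\beta,\widetilde{\mathcal Z})\le\min\big((1-\max(\alpha,\beta))\,\mathrm{area}(\widetilde{\mathcal Z}),\ 2(1-\min(\alpha,\beta))\,\widetilde\gamma(\widetilde{\mathcal Z}),\ \widetilde\gamma(\widetilde{\mathcal Z})\big).$$
   Context: $\widetilde R_{a,b}=[0,a]\times[0,b]$. A Euclidean zero-set is a closed $\widetilde{\mathcal Z}\subseteq[0,\infty)^2$ such that $(a,b)\in\widetilde{\mathcal Z}$ implies $\widetilde R_{a,b}\subseteq\widetilde{\mathcal Z}$, and $\widetilde{\mathcal Z}$ is the closure of $\widetilde{\mathcal Z}\cap(0,\infty)^2$. For Borel $A\subseteq[0,\infty)^2$, $\widetilde{\mathrm{row}}(x,A)$ (resp. $\widetilde{\mathrm{col}}(x,A)$) is the 1-dimensional Lebesgue measure of $A$ intersected with the horizontal (resp. vertical) line through $x$. For left-continuous nonincreasing $f,g:[0,\infty)\to[0,\infty)$ of compact support, $\widetilde{\mathcal T}(A)=A\cup\{(u,v):(\widetilde{\mathrm{row}}((u,v),A)+f(v),\widetilde{\mathrm{col}}((u,v),A)+g(u))\notin\widetilde{\mathcal Z}\}$; $A$ E-spans for $(\widetilde{\mathcal Z},f,g)$ if $\bigcup_n\widetilde{\mathcal T}^n(A)=[0,\infty)^2$.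 For bounded $\widetilde{\mathcal Z}$ and $(\alpha,\beta)\in[0,1]^2$: $\widetilde I(\alpha,\beta,\widetilde{\mathcal Z})=\inf\{\mathrm{area}(A)+(1-\alpha)\int_0^\infty f+(1-\beta)\int_0^\infty g\}$ over all $(A,f,g)$ with $A$ compact E-spanning for $(\widetilde{\mathcal Z},f,g)$; for general $\widetilde{\mathcal Z}$, $\widetilde I$ is defined as $\lim_{R\to\infty}$ of the value for $\widetilde{\mathcal Z}\cap[0,R]^2$. $\widetilde\gamma(\widetilde{\mathcal Z})=\widetilde I(0,0,\widetilde{\mathcal Z})$. *)

theory Defs
  imports "HOL-Analysis.Analysis"
begin

definition quadrant :: "(real \<times> real) set" where
  "quadrant = {0..} \<times> {0..}"

definition erect :: "real \<Rightarrow> real \<Rightarrow> (real \<times> real) set" where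
  "erect a b = {0..a} \<times> {0..b}"

definition ezero_set :: "(real \<times> real) set \<Rightarrow> bool" where
  "ezero_set Z \<longleftrightarrow> closed Z \<and> Z \<subseteq> quadrant
     \<and> (\<forall>a b. (a, b) \<in> Z \<longrightarrow> erect a b \<subseteq> Z)
     \<and> Z = closure (Z \<inter> ({0<..} \<times> {0<..}))"

definition erow :: "real \<times> real \<Rightarrow> (real \<times> real) set \<Rightarrow> ennreal" where
  "erow p A = emeasure lborel {t. (t, snd p) \<in> A}"

definition ecol :: "real \<times> real \<Rightarrow> (real \<times> real) set \<Rightarrow> ennreal" where
  "ecol p A = emeasure lborel {t. (fst p, t) \<in> A}"

definition in_zext :: "(real \<times> real) set \<Rightarrow> ennreal \<Rightarrow> ennreal \<Rightarrow> bool" where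
  "in_zext Z x y \<longleftrightarrow> x \<noteq> \<infinity> \<and> y \<noteq> \<infinity> \<and> (enn2real x, enn2real y) \<in> Z"

definition admissible_fun :: "(real \<Rightarrow> real) \<Rightarrow> bool" where
  "admissible_fun f \<longleftrightarrow> (\<forall>x\<ge>0. f x \<ge> 0)
     \<and> (\<forall>x y. 0 \<le> x \<longrightarrow> x \<le> y \<longrightarrow> f y \<le> f x)
     \<and> (\<forall>x>0. (f \<longlongrightarrow> f x) (at_left x))
     \<and> (\<exists>R. \<forall>x\<ge>R. f x = 0)"

definition eT :: "(real \<times> real) set \<Rightarrow> (real \<Rightarrow> real) \<Rightarrow> (real \<Rightarrow> real)
    \<Rightarrow> (real \<times> real) set \<Rightarrow> (real \<times> real) set" where
  "eT Z f g A = A \<union> {(u, v). (u, v) \<in> quadrant \<and>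
      \<not> in_zext Z (erow (u, v) A + ennreal (f v)) (ecol (u, v) A + ennreal (g u))}"

definition espans :: "(real \<times> real) set \<Rightarrow> (real \<Rightarrow> real) \<Rightarrow> (real \<Rightarrow> real)
    \<Rightarrow> (real \<times> real) set \<Rightarrow> bool" where
  "espans Z f g A \<longleftrightarrow> (\<Union>n. (eT Z f g ^^ n) A) = quadrant"

definition I_bdd :: "real \<Rightarrow> real \<Rightarrow> (real \<times> real) set \<Rightarrow> real" where
  "I_bdd \<alpha> \<beta> Z = Inf {measure lborel A + (1 - \<alpha>) * integral {0..} f + (1 - \<beta>) * integral {0..} g
      | A f g. compact A \<and> A \<subseteq> quadrant \<and> admissible_fun f \<and> admissible_fun g
               \<and> espans Z f g A}"

definition I_tilde :: "real \<Rightarrow> real \<Rightarrow> (real \<times> real) set \<Rightarrow> real" where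
  "I_tilde \<alpha> \<beta> Z = Lim at_top (\<lambda>R::real. I_bdd \<alpha> \<beta> (Z \<inter> erect R R))"

definition gamma_tilde :: "(real \<times> real) set \<Rightarrow> real" where
  "gamma_tilde Z = I_tilde 0 0 Z"

end

theory Submission
  imports Defs
begin

text \<open>
  All bounds are proved for the truncations \<open>Z \<inter> [0,R]\<^sup>2\<close> and survive the limit because the infimum
  is monotone in the zero-set. Comparing costs term by term gives \<open>I \<ge> (1 - max \<alpha> \<beta>) \<gamma>\<close> and
  \<open>I \<le> \<gamma>\<close>. Starting from the empty set with \<open>g = 0\<close> and \<open>f\<close> slightly above the row lengths of \<open>Z\<close>,
  horizontal strips fill up one after another, so \<open>I \<le> (1 - \<alpha>) area Z\<close>; the coordinate swap gives
  the same with \<open>\<beta>\<close>.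

  For \<open>I \<le> 2 (1 - min \<alpha> \<beta>) \<gamma>\<close>, a spanning triple \<open>(A, f, g)\<close> is replaced by \<open>({}, F, G)\<close>, where \<open>F\<close>
  and \<open>G\<close> are the decreasing rearrangements of \<open>f\<close> plus the row lengths of \<open>A\<close> and of \<open>g\<close> plus the
  column lengths of \<open>A\<close>. The new triple still spans, and the integrals of \<open>F\<close> and \<open>G\<close> exceed those
  of \<open>f\<close> and \<open>g\<close> by at most the area of \<open>A\<close> each.
\<close>

section \<open>Growth dynamics\<close>

text \<open>Stable under intersection with every square \<open>erect R R\<close>. The closure
  condition in \<open>ezero_set\<close> is not: at \<open>R = 0\<close> the intersection may be the
  single point \<open>(0, 0)\<close>, whose part in the open quadrant is empty.\<close>

definition lower_region :: "(real \<times> real) set \<Rightarrow> bool" where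
  "lower_region Z \<longleftrightarrow> closed Z \<and> Z \<subseteq> quadrant \<and> (\<forall>a b. (a, b) \<in> Z \<longrightarrow> erect a b \<subseteq> Z)"

lemma lower_regionD:
  assumes "lower_region Z" "(a, b) \<in> Z" "0 \<le> a'" "a' \<le> a" "0 \<le> b'" "b' \<le> b"
  shows "(a', b') \<in> Z"
proof -
  have "erect a b \<subseteq> Z" using assms(1,2) by (auto simp: lower_region_def)
  moreover have "(a', b') \<in> erect a b" using assms by (auto simp: erect_def)
  ultimately show ?thesis by blast
qed

text \<open>Down-closure of \<open>Z\<close>, extended to infinite lengths. Every comparison of
  growth processes rests on it: larger line totals can only push a point out of the
  zero-set.\<close>

lemma in_zext_mono:
  assumes Z: "lower_region Z" and "in_zext Z x' y'" "x \<le> x'" "y \<le> y'"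
  shows "in_zext Z x y"
proof -
  have fin: "x' < top" "y' < top" using assms(2) by (auto simp: in_zext_def less_top)
  hence "x < top" "y < top" using assms(3,4) by (auto intro: le_less_trans)
  moreover have "enn2real x \<le> enn2real x'" "enn2real y \<le> enn2real y'"
    using fin assms(3,4) by (auto intro: enn2real_mono)
  ultimately show ?thesis
    using assms(2) lower_regionD[OF Z] by (auto simp: in_zext_def)
qed

lemma in_zext_ennreal:
  "0 \<le> a \<Longrightarrow> 0 \<le> b \<Longrightarrow> in_zext Z (ennreal a) (ennreal b) \<longleftrightarrow> (a, b) \<in> Z"
  by (simp add: in_zext_def)

lemma in_zext_subset: "Z \<subseteq> Z' \<Longrightarrow> in_zext Z x y \<Longrightarrow> in_zext Z' x y"
  by (auto simp: in_zext_def)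

lemma mem_eT:
  "(u, v) \<in> eT Z f g A \<longleftrightarrow> (u, v) \<in> A \<or> (u, v) \<in> quadrant \<and>
    \<not> in_zext Z (erow (u, v) A + ennreal (f v)) (ecol (u, v) A + ennreal (g u))"
  by (auto simp: eT_def)

lemma funpow_eT_subset_quadrant: "A \<subseteq> quadrant \<Longrightarrow> (eT Z f g ^^ n) A \<subseteq> quadrant"
  by (induction n) (auto simp: eT_def)

lemma espansI:
  "A \<subseteq> quadrant \<Longrightarrow> (\<And>u v. (u, v) \<in> quadrant \<Longrightarrow> \<exists>n. (u, v) \<in> (eT Z f g ^^ n) A) \<Longrightarrow> espans Z f g A"
  unfolding espans_def by (rule equalityI) (use funpow_eT_subset_quadrant in blast, auto)

lemma admissible_fun_zero: "admissible_fun (\<lambda>_. 0)"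
  by (simp add: admissible_fun_def)

text \<open>Admissibility says nothing about negative arguments; clamping them to 0 makes the
  function nonincreasing on the whole line.\<close>

lemma admissible_fun_measurable:
  assumes "admissible_fun f"
  shows "(\<lambda>x. f (max 0 x)) \<in> borel_measurable borel"
proof -
  have "mono (\<lambda>x. - f (max 0 x))"
    using assms by (auto simp: mono_def admissible_fun_def)
  from borel_measurable_mono[OF this] show ?thesis
    by simp
qed

section \<open>Sections of planar Borel sets and Fubini\<close>

lemma horizontal_section_measurable:
  assumes "A \<in> sets (borel :: (real \<times> real) measure)"
  shows "{t. (t, v) \<in> A} \<in> sets borel"
proof -
  have "(\<lambda>t. (t, v)) -` A \<inter> space borel \<in> sets borel"
    by (rule measurable_sets[OF _ assms]) measurable
  thus ?thesis by (simp add: vimage_def)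
qed

lemma vertical_section_measurable:
  assumes "A \<in> sets (borel :: (real \<times> real) measure)"
  shows "{t. (u, t) \<in> A} \<in> sets borel"
proof -
  have "(\<lambda>t. (u, t)) -` A \<inter> space borel \<in> sets borel"
    by (rule measurable_sets[OF _ assms]) measurable
  thus ?thesis by (simp add: vimage_def)
qed

lemma horizontal_length_measurable:
  assumes "A \<in> sets (borel :: (real \<times> real) measure)"
  shows "(\<lambda>v. emeasure lborel {t. (t, v) \<in> A}) \<in> borel_measurable borel"
proof -
  have "A \<in> sets (lborel \<Otimes>\<^sub>M (lborel :: real measure))" using assms by (metis lborel_prod sets_lborel)
  from lborel_pair.measurable_emeasure_Pair2[OF this] show ?thesis by (simp add: vimage_def)
qed

lemma vertical_length_measurable:
  assumes "A \<in> sets (borel :: (real \<times> real) measure)"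
  shows "(\<lambda>u. emeasure lborel {t. (u, t) \<in> A}) \<in> borel_measurable borel"
proof -
  have "A \<in> sets (lborel \<Otimes>\<^sub>M (lborel :: real measure))" using assms by (metis lborel_prod sets_lborel)
  from lborel.measurable_emeasure_Pair[OF this] show ?thesis by (simp add: vimage_def)
qed

lemma emeasure_eq_horizontal:
  assumes "A \<in> sets (borel :: (real \<times> real) measure)"
  shows "emeasure lborel A = (\<integral>\<^sup>+ v. emeasure lborel {t. (t, v) \<in> A} \<partial>lborel)"
proof -
  have "A \<in> sets (lborel \<Otimes>\<^sub>M (lborel :: real measure))" using assms by (metis lborel_prod sets_lborel)
  from lborel_pair.emeasure_pair_measure_alt2[OF this] show ?thesis by (simp add: vimage_def lborel_prod)
qed

lemma emeasure_eq_vertical: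
  assumes "A \<in> sets (borel :: (real \<times> real) measure)"
  shows "emeasure lborel A = (\<integral>\<^sup>+ u. emeasure lborel {t. (u, t) \<in> A} \<partial>lborel)"
proof -
  have "A \<in> sets (lborel \<Otimes>\<^sub>M (lborel :: real measure))" using assms by (metis lborel_prod sets_lborel)
  from lborel.emeasure_pair_measure_alt[OF this] show ?thesis by (simp add: vimage_def lborel_prod)
qed

lemma quadrant_borel: "quadrant \<in> sets borel"
  unfolding quadrant_def by (simp add: borel_closed closed_Times)

text \<open>Since \<open>emeasure\<close> vanishes on non-measurable sets, monotonicity of the growth map
  depends on its iterates being Borel.\<close>

lemma eT_measurable:
  assumes A: "A \<in> sets borel" and Z: "closed Z" and f: "admissible_fun f" and g: "admissible_fun g"
  shows "eT Z f g A \<in> sets borel"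
proof -
  \<comment> \<open>Clamped row and column totals: measurable on the whole plane and, on the
    quadrant, equal to the totals in \<open>eT\<close>.\<close>
  define r where "r = (\<lambda>p::real\<times>real. emeasure lborel {t. (t, snd p) \<in> A} + ennreal (f (max 0 (snd p))))"
  define c where "c = (\<lambda>p::real\<times>real. emeasure lborel {t. (fst p, t) \<in> A} + ennreal (g (max 0 (fst p))))"
  have proj: "fst \<in> measurable borel (borel :: real measure)" "snd \<in> measurable borel (borel :: real measure)"
    by (intro borel_measurable_continuous_onI continuous_intros)+
  have [measurable]: "r \<in> borel_measurable borel" "c \<in> borel_measurable borel"
    unfolding r_def c_def
    using measurable_compose[OF proj(2) horizontal_length_measurable[OF A]]
      measurable_compose[OF proj(1) vertical_length_measurable[OF A]]
      measurable_compose[OF proj(2) admissible_fun_measurable[OF f]]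
      measurable_compose[OF proj(1) admissible_fun_measurable[OF g]]
    by (intro borel_measurable_add measurable_compose[OF _ measurable_ennreal]; simp)+
  have [measurable]: "(\<lambda>p. (enn2real (r p), enn2real (c p))) \<in> borel_measurable borel"
    by measurable
  have [measurable]: "Z \<in> sets borel" "quadrant \<in> sets borel"
    using Z quadrant_borel by (auto intro: borel_closed)
  have "{p. p \<in> quadrant \<and> \<not> (r p \<noteq> \<infinity> \<and> c p \<noteq> \<infinity> \<and> (enn2real (r p), enn2real (c p)) \<in> Z)} \<in> sets borel"
    by measurable
  moreover have "eT Z f g A = A \<union> {p. p \<in> quadrant \<and> \<not> (r p \<noteq> \<infinity> \<and> c p \<noteq> \<infinity> \<and> (enn2real (r p), enn2real (c p)) \<in> Z)}"
    unfolding eT_def in_zext_def erow_def ecol_def r_def c_def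
    by (auto simp: quadrant_def max_def)
  ultimately show ?thesis using A by auto
qed

lemma funpow_eT_measurable:
  assumes "A \<in> sets borel" "closed Z" "admissible_fun f" "admissible_fun g"
  shows "(eT Z f g ^^ n) A \<in> sets borel"
  by (induction n) (auto simp: assms eT_measurable)

lemma erow_mono: "A \<subseteq> B \<Longrightarrow> B \<in> sets borel \<Longrightarrow> erow p A \<le> erow p B"
  unfolding erow_def by (intro emeasure_mono) (auto simp: horizontal_section_measurable)

lemma ecol_mono: "A \<subseteq> B \<Longrightarrow> B \<in> sets borel \<Longrightarrow> ecol p A \<le> ecol p B"
  unfolding ecol_def by (intro emeasure_mono) (auto simp: vertical_section_measurable)

text \<open>A smaller zero-set is easier to leave, so by induction each stage for \<open>Z'\<close>
  is contained in the same stage for \<open>Z\<close>.\<close>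

lemma espans_antimono:
  assumes Z: "lower_region Z" "Z \<subseteq> Z'" and A: "A \<in> sets borel" "A \<subseteq> quadrant"
    and fg: "admissible_fun f" "admissible_fun g" and sp: "espans Z' f g A"
  shows "espans Z f g A"
proof -
  have cl: "closed Z" using Z by (simp add: lower_region_def)
  have "(eT Z' f g ^^ n) A \<subseteq> (eT Z f g ^^ n) A" for n
  proof (induction n)
    case (Suc n)
    let ?B = "(eT Z' f g ^^ n) A" and ?C = "(eT Z f g ^^ n) A"
    have C: "?C \<in> sets borel" by (rule funpow_eT_measurable[OF A(1) cl fg])
    have "\<not> in_zext Z' (erow p ?B + a) (ecol p ?B + b) \<Longrightarrow> \<not> in_zext Z (erow p ?C + a) (ecol p ?C + b)"
      for p a b
      using in_zext_mono[OF Z(1), of "erow p ?C + a" "ecol p ?C + b" "erow p ?B + a" "ecol p ?B + b"]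
        in_zext_subset[OF Z(2)] erow_mono[OF Suc.IH C] ecol_mono[OF Suc.IH C]
      by (auto intro: add_right_mono)
    thus ?case using Suc.IH by (auto simp: mem_eT)
  qed simp
  note sub = this
  show ?thesis
  proof (rule espansI[OF A(2)])
    fix u v :: real assume "(u, v) \<in> quadrant"
    then obtain n where "(u, v) \<in> (eT Z' f g ^^ n) A"
      using sp unfolding espans_def by auto
    thus "\<exists>n. (u, v) \<in> (eT Z f g ^^ n) A"
      using sub[of n] by (intro exI[of _ n]) (rule subsetD)
  qed
qed

section \<open>Symmetry under exchange of coordinates\<close>

lemma mem_swap_image: "p \<in> prod.swap ` A \<longleftrightarrow> prod.swap p \<in> A"
  by force

lemma eT_swap: "eT (prod.swap ` Z) g f (prod.swap ` A) = prod.swap ` eT Z f g A"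
proof -
  have "(u, v) \<in> eT (prod.swap ` Z) g f (prod.swap ` A) \<longleftrightarrow> (v, u) \<in> eT Z f g A" for u v
    unfolding mem_eT in_zext_def erow_def ecol_def mem_swap_image by (auto simp: quadrant_def)
  thus ?thesis by (auto simp: mem_swap_image)
qed

lemma espans_swap:
  assumes "espans Z f g A"
  shows "espans (prod.swap ` Z) g f (prod.swap ` A)"
proof -
  have "(eT (prod.swap ` Z) g f ^^ n) (prod.swap ` A) = prod.swap ` ((eT Z f g ^^ n) A)" for n
    by (induction n) (auto simp: eT_swap)
  thus ?thesis using assms unfolding espans_def
    by (simp add: image_UN[symmetric]) (auto simp: quadrant_def)
qed

text \<open>The lower estimate is automatic for a nonincreasing \<open>f\<close>; for the upper one,
  a single earlier point with value below \<open>c\<close> controls everything between it and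
  \<open>x\<close>.\<close>

lemma left_continuous_of_antimono:
  fixes f :: "real \<Rightarrow> real"
  assumes "0 < x" and anti: "\<And>y z. 0 \<le> y \<Longrightarrow> y \<le> z \<Longrightarrow> f z \<le> f y"
    and upper: "\<And>c. f x < c \<Longrightarrow> \<exists>y. 0 \<le> y \<and> y < x \<and> f y < c"
  shows "(f \<longlongrightarrow> f x) (at_left x)"
proof (rule order_tendstoI)
  fix a assume "a < f x"
  have "eventually (\<lambda>y. y \<in> {0<..<x}) (at_left x)"
    using \<open>0 < x\<close> by (rule eventually_at_left_real)
  thus "eventually (\<lambda>y. a < f y) (at_left x)"
    by eventually_elim (use \<open>a < f x\<close> anti in \<open>metis greaterThanLessThan_iff less_imp_le less_le_trans\<close>)
next
  fix a assume "f x < a"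
  then obtain y where y: "0 \<le> y" "y < x" "f y < a" using upper by blast
  have "eventually (\<lambda>z. z \<in> {y<..<x}) (at_left x)"
    using y by (intro eventually_at_left_real)
  thus "eventually (\<lambda>z. f z < a) (at_left x)"
    by eventually_elim (use y anti in \<open>metis greaterThanLessThan_iff less_imp_le le_less_trans\<close>)
qed

text \<open>Links the gauge integral in the cost, which is 0 by default when it does not exist, to a
  nonnegative Lebesgue integral. The latter is finite since \<open>f\<close> is at most
  \<open>f 0\<close> and vanishes far out.\<close>

lemma admissible_nn_integral:
  assumes f: "admissible_fun f"
  shows "ennreal (integral {0..} f) = (\<integral>\<^sup>+x\<in>{0..}. ennreal (f x) \<partial>lborel)" "0 \<le> integral {0..} f"
proof -
  obtain K where K: "\<And>x. x \<ge> K \<Longrightarrow> f x = 0" using f by (auto simp: admissible_fun_def)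
  define h where "h = (\<lambda>x. indicator {0..} x * f (max 0 x))"
  have nonneg: "0 \<le> h x" for x using f by (auto simp: h_def admissible_fun_def)
  have [measurable]: "h \<in> borel_measurable borel"
    unfolding h_def using admissible_fun_measurable[OF f] by measurable
  have le: "h x \<le> f 0 * indicator {0..max 0 K} x" for x
    using f K[of x] by (auto simp: h_def admissible_fun_def indicator_def)
  have "ennreal (h x) \<le> ennreal (f 0) * indicator {0..max 0 K} x" for x
    using ennreal_leI[OF le[of x]] by (cases "x \<in> {0..max 0 K}") auto
  hence "(\<integral>\<^sup>+x. ennreal (h x) \<partial>lborel) \<le> (\<integral>\<^sup>+x. ennreal (f 0) * indicator {0..max 0 K} x \<partial>lborel)"
    by (intro nn_integral_mono) auto
  also have "\<dots> < \<infinity>"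
    by (simp add: nn_integral_cmult ennreal_mult_less_top)
  finally have fin: "(\<integral>\<^sup>+x. ennreal (h x) \<partial>lborel) < \<infinity>" .
  then obtain r where r: "0 \<le> r" "(\<integral>\<^sup>+x. ennreal (h x) \<partial>lborel) = ennreal r"
    by (cases "\<integral>\<^sup>+x. ennreal (h x) \<partial>lborel") auto
  have "(h has_integral r) UNIV"
    by (rule nn_integral_has_integral) (use r nonneg in auto)
  hence "(f has_integral r) {0..}"
    by (subst has_integral_restrict_UNIV[symmetric])
       (simp add: h_def indicator_def max_def if_distrib cong: if_cong)
  hence i: "integral {0..} f = r" by (rule integral_unique)
  have "(\<integral>\<^sup>+x. ennreal (h x) \<partial>lborel) = (\<integral>\<^sup>+x\<in>{0..}. ennreal (f x) \<partial>lborel)"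
    by (intro nn_integral_cong) (auto simp: h_def indicator_def)
  thus "ennreal (integral {0..} f) = (\<integral>\<^sup>+x\<in>{0..}. ennreal (f x) \<partial>lborel)" "0 \<le> integral {0..} f"
    using r i by auto
qed

section \<open>The area bound\<close>

text \<open>Each step fills another strip of height \<open>e\<close>: at height \<open>v\<close> the
  column is already full up to \<open>v - e\<close>, which together with the enhancement
  \<open>f v\<close> leaves \<open>Z\<close>. Once the columns are full up to \<open>L > R\<close>,
  they leave \<open>Z\<close> on their own and one further step fills the quadrant.\<close>

lemma espans_strip:
  assumes Z: "lower_region Z" "Z \<subseteq> erect R R" and e: "0 < e" and L: "0 \<le> L" "R < L"
    and f: "admissible_fun f"
    and out: "\<And>v. 0 \<le> v \<Longrightarrow> v \<le> L \<Longrightarrow> (f v, max 0 (v - e)) \<notin> Z"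
  shows "espans Z f (\<lambda>_. 0) {}"
proof -
  let ?B = "\<lambda>n. (eT Z f (\<lambda>_. 0) ^^ n) {}"
  have cl: "closed Z" using Z(1) by (simp add: lower_region_def)
  have B: "?B n \<in> sets borel" for n by (rule funpow_eT_measurable[OF _ cl f admissible_fun_zero]) simp
  have col: "ennreal c \<le> ecol (u, v) (?B n)" if "\<And>t. 0 \<le> t \<Longrightarrow> t < c \<Longrightarrow> (u, t) \<in> ?B n" for c u v n
  proof (cases "0 \<le> c")
    case True
    have "emeasure lborel {0..<c} \<le> ecol (u, v) (?B n)"
      unfolding ecol_def using that vertical_section_measurable[OF B]
      by (intro emeasure_mono) auto
    thus ?thesis using True by simp
  qed (simp add: ennreal_neg)
  have strip: "(u, v) \<in> ?B n" if "0 \<le> u" "0 \<le> v" "v \<le> L" "v < n * e" for n u v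
    using that
  proof (induction n arbitrary: u v)
    case (Suc n)
    have "ennreal (max 0 (v - e)) \<le> ecol (u, v) (?B n)"
    proof (rule col)
      fix t assume t: "0 \<le> t" "t < max 0 (v - e)"
      hence "t < v - e" by simp
      thus "(u, t) \<in> ?B n"
        using Suc.prems t e by (intro Suc.IH) (auto simp: algebra_simps)
    qed
    moreover have "\<not> in_zext Z (ennreal (f v)) (ennreal (max 0 (v - e)))"
      using out[of v] Suc.prems f by (subst in_zext_ennreal) (auto simp: admissible_fun_def)
    ultimately have "\<not> in_zext Z (erow (u, v) (?B n) + ennreal (f v)) (ecol (u, v) (?B n) + ennreal 0)"
      using in_zext_mono[OF Z(1), of "erow (u, v) (?B n) + ennreal (f v)" "ecol (u, v) (?B n)"
          "ennreal (f v)" "ennreal (max 0 (v - e))"]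
      by (auto intro: add_increasing)
    thus ?case using Suc.prems by (simp add: mem_eT quadrant_def)
  qed simp
  obtain n :: nat where n: "L < n * e" using e by (meson ex_less_of_nat_mult)
  show ?thesis
  proof (rule espansI)
    fix u v :: real assume uv: "(u, v) \<in> quadrant"
    have "ennreal L \<le> ecol (u, v) (?B n)"
      using uv n by (intro col strip) (auto simp: quadrant_def)
    moreover have "\<not> in_zext Z 0 (ennreal L)"
      using Z(2) L by (auto simp: in_zext_def erect_def)
    ultimately have "\<not> in_zext Z (erow (u, v) (?B n) + ennreal (f v)) (ecol (u, v) (?B n) + ennreal 0)"
      using in_zext_mono[OF Z(1), of _ _ 0 "ennreal L"] by auto
    hence "(u, v) \<in> ?B (Suc n)" using uv by (simp add: mem_eT)
    thus "\<exists>n. (u, v) \<in> ?B n" by blast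
  qed simp
qed

text \<open>In the error term, \<open>e * R\<close> pays for the delay and
  \<open>e * (R + e)\<close> for the lift that turn the row lengths of \<open>Z\<close> into an
  enhancement satisfying the hypotheses of \<open>espans_strip\<close>.\<close>

lemma bounded_region_enhancement:
  assumes Z: "lower_region Z" "Z \<subseteq> erect R R" and R: "0 \<le> R" and e: "0 < e"
  obtains f where "admissible_fun f" "espans Z f (\<lambda>_. 0) {}"
    "(\<integral>\<^sup>+x\<in>{0..}. ennreal (f x) \<partial>lborel) \<le> emeasure lborel Z + ennreal (e * (2 * R + e))"
proof -
  define h where "h v = measure lborel {t. (t, v) \<in> Z}" for v
  have cl: "closed Z" using Z(1) by (simp add: lower_region_def)
  hence Zb: "Z \<in> sets borel" by (rule borel_closed)
  note sec = horizontal_section_measurable[OF Zb]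
  have sub: "{t. (t, v) \<in> Z} \<subseteq> {0..R}" for v using Z(2) by (auto simp: erect_def)
  have fin: "emeasure lborel {t. (t, v) \<in> Z} = ennreal (h v)" for v
  proof -
    have "emeasure lborel {t. (t, v) \<in> Z} \<le> emeasure lborel {0..R}" by (intro emeasure_mono sub) simp
    hence "emeasure lborel {t. (t, v) \<in> Z} < top" using R by (simp add: order_le_less_trans)
    thus ?thesis unfolding h_def by (intro emeasure_eq_ennreal_measure) auto
  qed
  have h0: "0 \<le> h v" for v by (simp add: h_def)
  \<comment> \<open>By down-closure each nonempty row of \<open>Z\<close> is an interval starting at
    0 with right endpoint \<open>h v\<close>: points outside \<open>Z\<close> lie at or beyond it,
    points inside at or before it (\<open>h_ge\<close>).\<close>
  have h_le: "h v \<le> c" if "(c, v) \<notin> Z" "0 \<le> c" "0 \<le> v" for c v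
  proof -
    have "{t. (t, v) \<in> Z} \<subseteq> {0..c}"
    proof
      fix t assume t: "t \<in> {t. (t, v) \<in> Z}"
      hence "\<not> c < t" using lower_regionD[OF Z(1), of t v c v] that by force
      thus "t \<in> {0..c}" using t sub[of v] by auto
    qed
    hence "emeasure lborel {t. (t, v) \<in> Z} \<le> emeasure lborel {0..c}" by (intro emeasure_mono) auto
    thus ?thesis using that by (simp add: fin)
  qed
  have h_ge: "c \<le> h v" if "(c, v) \<in> Z" for c v
  proof -
    have "0 \<le> c" "0 \<le> v" using that Z(1) by (auto simp: lower_region_def quadrant_def)
    hence "{0..c} \<subseteq> {t. (t, v) \<in> Z}" using lower_regionD[OF Z(1) that] by auto
    hence "emeasure lborel {0..c} \<le> emeasure lborel {t. (t, v) \<in> Z}" using sec by (intro emeasure_mono) auto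
    thus ?thesis using \<open>0 \<le> c\<close> h0 by (simp add: fin)
  qed
  have h_anti: "h z \<le> h y" if "0 \<le> y" "y \<le> z" for y z
  proof -
    have "{t. (t, z) \<in> Z} \<subseteq> {t. (t, y) \<in> Z}"
      using that lower_regionD[OF Z(1)] Z(1) by (fastforce simp: lower_region_def quadrant_def)
    hence "emeasure lborel {t. (t, z) \<in> Z} \<le> emeasure lborel {t. (t, y) \<in> Z}"
      using sec by (intro emeasure_mono) auto
    thus ?thesis using h0 by (simp add: fin)
  qed
  have h_R: "h v \<le> R" for v
  proof -
    have "emeasure lborel {t. (t, v) \<in> Z} \<le> emeasure lborel {0..R}" by (intro emeasure_mono sub) simp
    thus ?thesis using R by (simp add: fin)
  qed
  \<comment> \<open>Left-continuity of \<open>h\<close> comes from closedness of \<open>Z\<close>: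
    for \<open>d\<close> strictly between \<open>h x\<close> and \<open>c\<close>, a whole ball
    around \<open>(d, x)\<close> misses \<open>Z\<close>, so the row at a slightly smaller
    \<open>y\<close> also ends by \<open>d\<close>.\<close>
  have h_left: "\<exists>y. 0 \<le> y \<and> y < x \<and> h y < c" if x: "0 < x" and "h x < c" for x c
  proof -
    obtain d where d: "h x < d" "d < c" using \<open>h x < c\<close> dense by blast
    have "(d, x) \<in> - Z" using h_ge d by force
    then obtain r where r: "0 < r" "ball (d, x) r \<subseteq> - Z"
      using cl open_contains_ball[of "- Z"] by (auto simp: open_Compl)
    define y where "y = max (x / 2) (x - r / 2)"
    have y: "0 \<le> y" "y < x" "x - y < r" using x r by (auto simp: y_def max_def)
    hence "(d, y) \<in> ball (d, x) r" by (simp add: dist_Pair_Pair dist_real_def)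
    hence "(d, y) \<notin> Z" using r by auto
    moreover have "0 \<le> d" using d h0[of x] by linarith
    ultimately have "h y < c" using h_le[of d y] y d by fastforce
    thus ?thesis using y by blast
  qed
  \<comment> \<open>Delaying the row lengths of \<open>Z\<close> by \<open>e\<close> and lifting them by \<open>e\<close> makes every row outgrow \<open>Z\<close>
    once the strip of height \<open>e\<close> below it is full.\<close>
  define L where "L = R + e"
  define f where "f v = (if v \<le> L then h (max 0 (v - e)) + e else 0)" for v
  have f_anti: "f z \<le> f y" if "0 \<le> y" "y \<le> z" for y z
    using that h_anti[of "max 0 (y - e)" "max 0 (z - e)"] h0[of "max 0 (y - e)"] e
    by (auto simp: f_def)
  have f_adm: "admissible_fun f"
    unfolding admissible_fun_def
  proof (intro conjI allI impI)
    show "0 \<le> f x" for x using h0 e by (auto simp: f_def add_nonneg_nonneg less_imp_le)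
    show "\<exists>K. \<forall>x\<ge>K. f x = 0" by (intro exI[of _ "L + 1"]) (auto simp: f_def)
    fix x :: real assume x: "0 < x"
    show "(f \<longlongrightarrow> f x) (at_left x)"
    proof (rule left_continuous_of_antimono[OF x f_anti])
      fix c assume c: "f x < c"
      \<comment> \<open>The cutoff keeps \<open>f\<close> positive at \<open>L\<close> itself, so
        the drop to 0 occurs only to the right of \<open>L\<close>. Up to \<open>e\<close> the
        delayed function is constant, and past \<open>e\<close> the left-continuity of
        \<open>h\<close> is shifted.\<close>
      consider "L < x" | "x \<le> L" "x \<le> e" | "x \<le> L" "e < x" by linarith
      thus "\<exists>y\<ge>0. y < x \<and> f y < c"
      proof cases
        case 1
        thus ?thesis using R e c by (intro exI[of _ "(L + x) / 2"]) (auto simp: f_def L_def)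
      next
        case 2
        hence "max 0 (x - e) = 0" "max 0 (x / 2 - e) = 0" using e by auto
        thus ?thesis using 2 x c by (intro exI[of _ "x / 2"]) (auto simp: f_def)
      next
        case 3
        hence "h (x - e) < c - e" using c by (simp add: f_def)
        then obtain y where "0 \<le> y" "y < x - e" "h y < c - e" using h_left[of "x - e"] 3 by auto
        thus ?thesis using e 3 by (intro exI[of _ "y + e"]) (auto simp: f_def)
      qed
    qed
  qed (use f_anti in auto)
  have span: "espans Z f (\<lambda>_. 0) {}"
  proof (rule espans_strip[OF Z e _ _ f_adm])
    show "0 \<le> L" "R < L" using R e by (auto simp: L_def)
    fix v assume "0 \<le> v" "v \<le> L"
    thus "(f v, max 0 (v - e)) \<notin> Z"
      using h_ge[of "f v" "max 0 (v - e)"] e by (auto simp: f_def)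
  qed
  have hm: "(\<lambda>v. ennreal (h v)) \<in> borel_measurable borel"
    using horizontal_length_measurable[OF Zb] by (simp add: fin)
  \<comment> \<open>Up to \<open>e\<close> the delay repeats the value \<open>h 0\<close>, which is
    at most \<open>R\<close>; afterwards only the shifted \<open>h\<close> and the lift
    remain.\<close>
  have le: "ennreal (f x) * indicator {0..} x \<le>
      ennreal R * indicator {0..e} x + ennreal (h (x - e)) + ennreal e * indicator {0..L} x" for x
  proof -
    consider "x < 0" | "L < x" | "0 \<le> x" "x \<le> L" "x \<le> e" | "0 \<le> x" "x \<le> L" "e < x" by linarith
    thus ?thesis
    proof cases
      case 3
      hence "ennreal (f x) = ennreal (h 0) + ennreal e" using e h0 by (simp add: f_def ennreal_plus)
      also have "\<dots> \<le> ennreal R + ennreal (h (x - e)) + ennreal e"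
        using h_R[of 0] by (intro add_mono) (auto intro: add_increasing2 ennreal_leI)
      finally show ?thesis using 3 by simp
    next
      case 4
      hence "ennreal (f x) = ennreal (h (x - e)) + ennreal e" using e h0 by (simp add: f_def ennreal_plus)
      thus ?thesis using 4 by simp
    qed (auto simp: f_def)
  qed
  have shift: "(\<integral>\<^sup>+x. ennreal (h (x - e)) \<partial>lborel) = emeasure lborel Z"
  proof -
    have "(\<integral>\<^sup>+x. ennreal (h (x - e)) \<partial>lborel) = (\<integral>\<^sup>+x. ennreal (h x) \<partial>lborel)"
      using hm nn_integral_real_affine[of "\<lambda>x. ennreal (h x)" 1 "- e"] by (simp add: algebra_simps)
    thus ?thesis by (simp add: emeasure_eq_horizontal[OF Zb] fin)
  qed
  have hm': "(\<lambda>v. ennreal (h (v - e))) \<in> borel_measurable borel"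
    using measurable_compose[OF _ hm, of "\<lambda>v. v - e" borel] by simp
  have "(\<integral>\<^sup>+x\<in>{0..}. ennreal (f x) \<partial>lborel) \<le> (\<integral>\<^sup>+x. ennreal R * indicator {0..e} x + ennreal (h (x - e)) + ennreal e * indicator {0..L} x \<partial>lborel)"
    by (intro nn_integral_mono le)
  also have "\<dots> = ennreal R * ennreal e + emeasure lborel Z + ennreal e * ennreal L"
    using hm' e R by (simp add: nn_integral_add nn_integral_cmult shift L_def)
  also have "\<dots> = emeasure lborel Z + ennreal (e * (2 * R + e))"
  proof -
    have "ennreal R * ennreal e + ennreal e * ennreal L = ennreal (e * (2 * R + e))"
      using R e by (simp add: ennreal_mult[symmetric] ennreal_plus[symmetric] L_def algebra_simps del: ennreal_plus)
    thus ?thesis by (metis add.commute add.left_commute)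
  qed
  finally show thesis using that f_adm span by blast
qed

section \<open>Decreasing rearrangement\<close>

text \<open>Both sides are the area of the region under the graph of \<open>p\<close> over the
  nonnegative half-line, computed by columns and by rows.\<close>

lemma layer_cake:
  fixes p :: "real \<Rightarrow> real"
  assumes [measurable]: "p \<in> borel_measurable borel"
  shows "(\<integral>\<^sup>+x\<in>{0..}. ennreal (p x) \<partial>lborel)
    = (\<integral>\<^sup>+t\<in>{0..}. emeasure lborel {x. 0 \<le> x \<and> t < p x} \<partial>lborel)"
proof -
  let ?S = "{q :: real \<times> real. 0 \<le> fst q \<and> 0 \<le> snd q \<and> snd q < p (fst q)}"
  have "{q \<in> space (borel \<Otimes>\<^sub>M borel). 0 \<le> fst q \<and> 0 \<le> snd q \<and> snd q < p (fst q)}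
      \<in> sets (borel \<Otimes>\<^sub>M (borel :: real measure))" by measurable
  hence S: "?S \<in> sets borel" unfolding borel_prod[symmetric] by (simp add: space_pair_measure)
  have "(\<integral>\<^sup>+x\<in>{0..}. ennreal (p x) \<partial>lborel) = (\<integral>\<^sup>+x. emeasure lborel {t. (x, t) \<in> ?S} \<partial>lborel)"
  proof (intro nn_integral_cong)
    fix x :: real
    have "{t. (x, t) \<in> ?S} = (if 0 \<le> x then {0..<p x} else {})" by auto
    thus "ennreal (p x) * indicator {0..} x = emeasure lborel {t. (x, t) \<in> ?S}"
      by (cases "0 \<le> p x") (auto simp: ennreal_neg)
  qed
  also have "\<dots> = emeasure lborel ?S" by (rule emeasure_eq_vertical[OF S, symmetric])
  also have "\<dots> = (\<integral>\<^sup>+t. emeasure lborel {x. (x, t) \<in> ?S} \<partial>lborel)" by (rule emeasure_eq_horizontal[OF S])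
  also have "\<dots> = (\<integral>\<^sup>+t\<in>{0..}. emeasure lborel {x. 0 \<le> x \<and> t < p x} \<partial>lborel)"
    by (intro nn_integral_cong) (auto simp: indicator_def)
  finally show ?thesis .
qed

text \<open>Treats open rays, closed rays, the empty set and the whole line alike; the superlevel
  sets of filled crossings met later do not reveal whether their endpoint is attained.\<close>

definition up_closed :: "real set \<Rightarrow> bool" where
  "up_closed U \<longleftrightarrow> (\<forall>s\<in>U. \<forall>t\<ge>s. t \<in> U)"

lemma up_closed_borel: "up_closed U \<Longrightarrow> U \<in> sets borel"
  by (intro real_interval_borel_measurable) (auto simp: is_interval_1 up_closed_def)

text \<open>Lets a bounded profile of bounded support be replaced by an admissible one: the first
  estimate controls the cost, the second ensures that superlevel sets, and hence filled portions of
  lines, do not shrink.\<close>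

lemma decreasing_rearrangement:
  fixes p :: "real \<Rightarrow> real"
  assumes p[measurable]: "p \<in> borel_measurable borel" and nonneg: "\<And>x. 0 \<le> x \<Longrightarrow> 0 \<le> p x"
    and bound: "\<And>x. 0 \<le> x \<Longrightarrow> p x \<le> M" and supp: "\<And>x. K \<le> x \<Longrightarrow> p x = 0"
  obtains F where "admissible_fun F"
    "(\<integral>\<^sup>+x\<in>{0..}. ennreal (F x) \<partial>lborel) \<le> (\<integral>\<^sup>+x\<in>{0..}. ennreal (p x) \<partial>lborel)"
    "\<And>U. up_closed U \<Longrightarrow>
      emeasure lborel {x. 0 \<le> x \<and> p x \<in> U} \<le> emeasure lborel {x. 0 \<le> x \<and> F x \<in> U}"
proof -
  \<comment> \<open>\<open>F\<close> is the generalised inverse of the distribution function \<open>D\<close>; the ray \<open>{M..}\<close> only keeps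
    the infimum meaningful at \<open>v = 0\<close>.\<close>
  define D where "D t = measure lborel {x. 0 \<le> x \<and> t < p x}" for t
  define V where "V v = {t. 0 \<le> t \<and> D t < v} \<union> {M..}" for v
  define F where "F v = Inf (V v)" for v
  have M: "0 \<le> M" using nonneg[of 0] bound[of 0] by simp
  have "{x. 0 \<le> x \<and> t < p x} \<in> sets (borel :: real measure)" for t by measurable
  hence D_sets: "{x. 0 \<le> x \<and> t < p x} \<in> sets lborel" for t by simp
  have D_sub: "{x. 0 \<le> x \<and> t < p x} \<subseteq> {0..max 0 K}" if "0 \<le> t" for t
  proof
    fix x assume x: "x \<in> {x. 0 \<le> x \<and> t < p x}"
    hence "\<not> K \<le> x" using supp[of x] that by auto
    thus "x \<in> {0..max 0 K}" using x by auto
  qed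
  have D_eq: "emeasure lborel {x. 0 \<le> x \<and> t < p x} = ennreal (D t)" if "0 \<le> t" for t
  proof -
    have "emeasure lborel {x. 0 \<le> x \<and> t < p x} \<le> emeasure lborel {0..max 0 K}"
      by (intro emeasure_mono D_sub that) simp
    hence "emeasure lborel {x. 0 \<le> x \<and> t < p x} < top" by (simp add: order_le_less_trans)
    thus ?thesis unfolding D_def by (intro emeasure_eq_ennreal_measure) auto
  qed
  have D_anti: "D t \<le> D s" if "0 \<le> s" "s \<le> t" for s t
  proof -
    have "emeasure lborel {x. 0 \<le> x \<and> t < p x} \<le> emeasure lborel {x. 0 \<le> x \<and> s < p x}"
      using that by (intro emeasure_mono D_sets) auto
    thus ?thesis using that D_eq by (simp add: D_def)
  qed
  have D_M: "D t = 0" if "M \<le> t" for t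
  proof -
    have "{x. 0 \<le> x \<and> t < p x} = {}" using bound that by force
    thus ?thesis unfolding D_def by (simp only: measure_empty)
  qed
  have bdd: "bdd_below (V v)" for v by (rule bdd_belowI[of _ 0]) (use M in \<open>auto simp: V_def\<close>)
  have ne: "V v \<noteq> {}" for v by (auto simp: V_def)
  have V0: "0 \<le> t" if "t \<in> V v" for t v using that M by (auto simp: V_def)
  have F0: "0 \<le> F v" for v unfolding F_def by (rule cInf_greatest[OF ne V0])
  have F_le: "F v \<le> t" if "t \<in> V v" for v t unfolding F_def by (rule cInf_lower[OF that bdd])
  have V_anti: "V y \<subseteq> V z" if "y \<le> z" for y z using that by (auto simp: V_def)
  have F_anti: "F z \<le> F y" if "y \<le> z" for y z
    unfolding F_def by (rule cInf_superset_mono[OF ne bdd V_anti[OF that]])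
  have F_less: "\<exists>t\<in>V v. t < c" if "F v < c" for v c
    using that cInf_less_iff[OF ne bdd] unfolding F_def by blast
  have pos_V: "t \<in> V v \<longleftrightarrow> 0 \<le> t \<and> D t < v" if "0 < v" for t v
    using that D_M M by (auto simp: V_def)
  have adm: "admissible_fun F"
    unfolding admissible_fun_def
  proof (intro conjI allI impI)
    have "F x = 0" if "max 0 (D 0) + 1 \<le> x" for x
    proof (rule antisym[OF _ F0])
      show "F x \<le> 0" by (rule F_le) (use that in \<open>auto simp: V_def\<close>)
    qed
    thus "\<exists>R. \<forall>x\<ge>R. F x = 0" by blast
    fix x :: real assume x: "0 < x"
    show "(F \<longlongrightarrow> F x) (at_left x)"
    proof (rule left_continuous_of_antimono[OF x F_anti])
      fix c assume "F x < c"
      then obtain t where t: "t \<in> V x" "t < c" using F_less by blast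
      hence "0 \<le> t" "D t < x" using pos_V[OF x] by auto
      \<comment> \<open>The strict inequality in \<open>V\<close> leaves room for this midpoint;
        that is what makes \<open>F\<close> left-continuous.\<close>
      define y where "y = (D t + x) / 2"
      have "0 \<le> D t" by (simp add: D_def)
      hence y: "0 < y" "y < x" "D t < y" using x \<open>D t < x\<close> by (auto simp: y_def)
      hence "F y \<le> t" using \<open>0 \<le> t\<close> pos_V by (intro F_le) auto
      thus "\<exists>y\<ge>0. y < x \<and> F y < c" using t y by (intro exI[of _ y]) auto
    qed
  qed (use F0 F_anti in auto)
  \<comment> \<open>Right-continuity of \<open>D\<close>, obtained from continuity of measure from
    below: just above \<open>F v\<close> the values of \<open>D\<close> are at most
    \<open>v\<close>, and the sets where \<open>p\<close> exceeds \<open>F v + 1 / (n + 1)\<close>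
    increase to the set where it exceeds \<open>F v\<close>.\<close>
  have DF: "D (F v) \<le> v" if "0 \<le> v" for v
  proof (rule ccontr)
    assume "\<not> D (F v) \<le> v"
    hence gt: "v < D (F v)" by simp
    let ?A = "\<lambda>n. {x. 0 \<le> x \<and> F v + 1 / real (Suc n) < p x}"
    have "(\<lambda>n. emeasure lborel (?A n)) \<longlonglongrightarrow> emeasure lborel (\<Union>n. ?A n)"
    proof (rule Lim_emeasure_incseq)
      show "incseq ?A"
      proof (rule incseq_SucI)
        fix n
        have "1 / real (Suc (Suc n)) \<le> 1 / real (Suc n)" by (simp add: frac_le)
        thus "?A n \<subseteq> ?A (Suc n)" by auto
      qed
    qed (use D_sets in auto)
    moreover have "(\<Union>n. ?A n) = {x. 0 \<le> x \<and> F v < p x}"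
    proof (intro equalityI subsetI)
      fix x assume x: "x \<in> {x. 0 \<le> x \<and> F v < p x}"
      hence "0 < p x - F v" by simp
      then obtain n where "inverse (real (Suc n)) < p x - F v" using reals_Archimedean by blast
      thus "x \<in> (\<Union>n. ?A n)" using x by (auto simp: inverse_eq_divide intro!: exI[of _ n])
    next
      fix x assume "x \<in> (\<Union>n. ?A n)"
      then obtain n where "0 \<le> x" "F v + 1 / real (Suc n) < p x" by blast
      moreover have "0 < 1 / real (Suc n)" by simp
      ultimately have "F v < p x" by linarith
      thus "x \<in> {x. 0 \<le> x \<and> F v < p x}" using \<open>0 \<le> x\<close> by simp
    qed
    ultimately have "(\<lambda>n. ennreal (D (F v + 1 / real (Suc n)))) \<longlonglongrightarrow> ennreal (D (F v))"
      using D_eq F0 by simp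
    moreover have "ennreal (D (F v + 1 / real (Suc n))) \<le> ennreal v" for n
    proof (rule ennreal_leI)
      have "F v < F v + 1 / real (Suc n)" by simp
      then obtain t where t: "t \<in> V v" "t < F v + 1 / real (Suc n)" using F_less by blast
      hence "D (F v + 1 / real (Suc n)) \<le> D t" using V0 by (intro D_anti) auto
      also have "D t \<le> v" using t that D_M by (auto simp: V_def)
      finally show "D (F v + 1 / real (Suc n)) \<le> v" .
    qed
    ultimately have "ennreal (D (F v)) \<le> ennreal v"
      by (intro LIMSEQ_le_const2) auto
    thus False using gt that by simp
  qed
  have Fm: "F \<in> borel_measurable borel"
  proof -
    have "mono (\<lambda>x. - F x)" using F_anti by (auto simp: mono_def)
    from borel_measurable_mono[OF this] show ?thesis by simp
  qed
  have "(\<integral>\<^sup>+x\<in>{0..}. ennreal (F x) \<partial>lborel) \<le> (\<integral>\<^sup>+x\<in>{0..}. ennreal (p x) \<partial>lborel)"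
    unfolding layer_cake[OF Fm] layer_cake[OF p]
  proof (intro nn_integral_mono)
    fix t :: real
    show "emeasure lborel {x. 0 \<le> x \<and> t < F x} * indicator {0..} t
        \<le> emeasure lborel {x. 0 \<le> x \<and> t < p x} * indicator {0..} t"
    proof (cases "0 \<le> t")
      case True
      have "{x. 0 \<le> x \<and> t < F x} \<subseteq> {0..D t}"
      proof
        fix x assume x: "x \<in> {x. 0 \<le> x \<and> t < F x}"
        hence "t \<notin> V x" using F_le[of t x] by auto
        thus "x \<in> {0..D t}" using x True by (auto simp: V_def)
      qed
      hence "emeasure lborel {x. 0 \<le> x \<and> t < F x} \<le> emeasure lborel {0..D t}" by (intro emeasure_mono) auto
      also have "\<dots> = emeasure lborel {x. 0 \<le> x \<and> t < p x}" using D_eq[OF True] by (simp add: D_def)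
      finally show ?thesis using True by simp
    qed simp
  qed
  moreover have "emeasure lborel {x. 0 \<le> x \<and> p x \<in> U} \<le> emeasure lborel {x. 0 \<le> x \<and> F x \<in> U}"
    if U: "up_closed U" for U
  proof -
    have [measurable]: "U \<in> sets borel" using U by (rule up_closed_borel)
    note [measurable] = Fm
    have "{x. 0 \<le> x \<and> F x \<in> U} \<in> sets (borel :: real measure)" by measurable
    hence FU: "{x. 0 \<le> x \<and> F x \<in> U} \<in> sets lborel" by simp
    \<comment> \<open>If \<open>F v\<close> is not in \<open>U\<close>, all of \<open>U\<close> lies
      above \<open>F v\<close>, so the measure is at most \<open>D (F v)\<close>, which is at most
      \<open>v\<close>.\<close>
    have below: "emeasure lborel {x. 0 \<le> x \<and> p x \<in> U} \<le> ennreal v" if "0 \<le> v" "F v \<notin> U" for v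
    proof -
      have "emeasure lborel {x. 0 \<le> x \<and> p x \<in> U} \<le> emeasure lborel {x. 0 \<le> x \<and> F v < p x}"
        using U that by (intro emeasure_mono D_sets) (auto simp: up_closed_def not_le[symmetric])
      also have "\<dots> \<le> ennreal v" using DF[OF that(1)] D_eq[OF F0] by (simp add: ennreal_leI)
      finally show ?thesis .
    qed
    show ?thesis
    proof (cases "\<exists>v\<ge>0. F v \<notin> U")
      \<comment> \<open>The measure is then a finite number \<open>r\<close>, and by contraposition
        of \<open>below\<close> every \<open>v < r\<close> has \<open>F v\<close> in
        \<open>U\<close>.\<close>
      case True
      then obtain r where r: "0 \<le> r" "emeasure lborel {x. 0 \<le> x \<and> p x \<in> U} = ennreal r"
        using below by (metis ennreal_cases ennreal_neq_top neq_top_trans)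
      have "{0..<r} \<subseteq> {x. 0 \<le> x \<and> F x \<in> U}"
      proof
        fix v assume v: "v \<in> {0..<r}"
        hence "F v \<in> U" using below[of v] r by (cases "F v \<in> U") auto
        thus "v \<in> {x. 0 \<le> x \<and> F x \<in> U}" using v by auto
      qed
      hence "emeasure lborel {0..<r} \<le> emeasure lborel {x. 0 \<le> x \<and> F x \<in> U}"
        by (intro emeasure_mono FU)
      thus ?thesis using r by simp
    next
      case False
      hence "{x. 0 \<le> x \<and> p x \<in> U} \<subseteq> {x. 0 \<le> x \<and> F x \<in> U}" by auto
      thus ?thesis by (intro emeasure_mono FU)
    qed
  qed
  ultimately show thesis using that adm by blast
qed

section \<open>Eliminating the initial set\<close>

text \<open>With \<open>a\<close> the section lengths of the initial set, the integral of
  \<open>a\<close> is its area, so absorbing the set into the enhancement raises the cost by at most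
  that area.\<close>

lemma enhanced_rearrangement:
  fixes a :: "real \<Rightarrow> real"
  assumes f: "admissible_fun f" and a[measurable]: "a \<in> borel_measurable borel"
    and a0: "\<And>x. 0 \<le> a x" and aM: "\<And>x. a x \<le> M" and supp: "\<And>x. K < x \<Longrightarrow> a x = 0"
  obtains F where "admissible_fun F"
    "ennreal (integral {0..} F) \<le> ennreal (integral {0..} f) + (\<integral>\<^sup>+x. ennreal (a x) \<partial>lborel)"
    "\<And>U. up_closed U \<Longrightarrow> {x. 0 \<le> x \<and> f x + a x \<in> U} \<in> sets borel \<and>
      emeasure lborel {x. 0 \<le> x \<and> f x + a x \<in> U} \<le> emeasure lborel {x. 0 \<le> x \<and> F x \<in> U}"
proof -
  obtain K' where K': "\<And>x. K' \<le> x \<Longrightarrow> f x = 0" using f by (auto simp: admissible_fun_def)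
  define p where "p x = f (max 0 x) + a x" for x
  have [measurable]: "(\<lambda>x. f (max 0 x)) \<in> borel_measurable borel" by (rule admissible_fun_measurable[OF f])
  have pm[measurable]: "p \<in> borel_measurable borel" unfolding p_def by measurable
  have p_eq: "p x = f x + a x" if "0 \<le> x" for x using that by (simp add: p_def)
  have p0: "0 \<le> p x" if "0 \<le> x" for x using that a0[of x] f by (simp add: p_def admissible_fun_def)
  have pM: "p x \<le> f 0 + M" if "0 \<le> x" for x
    using that aM[of x] f by (auto simp: p_def admissible_fun_def intro!: add_mono)
  \<comment> \<open>\<open>K + 1\<close> turns the strict threshold for \<open>a\<close> into a weak
    one for \<open>p\<close>; the outer 0 removes the clamping.\<close>
  have pz: "p x = 0" if "max 0 (max (K + 1) K') \<le> x" for x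
    using that supp[of x] K'[of x] by (simp add: p_def)
  obtain F where F: "admissible_fun F"
    "(\<integral>\<^sup>+x\<in>{0..}. ennreal (F x) \<partial>lborel) \<le> (\<integral>\<^sup>+x\<in>{0..}. ennreal (p x) \<partial>lborel)"
    "\<And>U. up_closed U \<Longrightarrow>
      emeasure lborel {x. 0 \<le> x \<and> p x \<in> U} \<le> emeasure lborel {x. 0 \<le> x \<and> F x \<in> U}"
    using decreasing_rearrangement[OF pm p0 pM pz] by blast
  have "(\<integral>\<^sup>+x\<in>{0..}. ennreal (p x) \<partial>lborel)
      \<le> (\<integral>\<^sup>+x. ennreal (f (max 0 x)) * indicator {0..} x + ennreal (a x) \<partial>lborel)"
    using f a0 by (intro nn_integral_mono) (auto simp: p_def indicator_def admissible_fun_def ennreal_plus)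
  also have "\<dots> = (\<integral>\<^sup>+x\<in>{0..}. ennreal (f (max 0 x)) \<partial>lborel) + (\<integral>\<^sup>+x. ennreal (a x) \<partial>lborel)"
    by (rule nn_integral_add) measurable
  also have "(\<integral>\<^sup>+x\<in>{0..}. ennreal (f (max 0 x)) \<partial>lborel) = ennreal (integral {0..} f)"
    unfolding admissible_nn_integral(1)[OF f] by (intro nn_integral_cong) (auto simp: indicator_def)
  finally have "ennreal (integral {0..} F) \<le> ennreal (integral {0..} f) + (\<integral>\<^sup>+x. ennreal (a x) \<partial>lborel)"
    using F(2) by (simp add: admissible_nn_integral(1)[OF F(1)])
  moreover have "{x. 0 \<le> x \<and> f x + a x \<in> U} \<in> sets borel \<and>
      emeasure lborel {x. 0 \<le> x \<and> f x + a x \<in> U} \<le> emeasure lborel {x. 0 \<le> x \<and> F x \<in> U}"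
    if U: "up_closed U" for U
  proof -
    have [measurable]: "U \<in> sets borel" using U by (rule up_closed_borel)
    have "{x. 0 \<le> x \<and> p x \<in> U} \<in> sets (borel :: real measure)" by measurable
    moreover have "{x. 0 \<le> x \<and> p x \<in> U} = {x. 0 \<le> x \<and> f x + a x \<in> U}" using p_eq by auto
    ultimately show ?thesis using F(3)[OF U] by simp
  qed
  ultimately show thesis using that F(1) by blast
qed

text \<open>Compares one line in the two processes. \<open>S\<close> is the old filled part, covered
  by the trace \<open>B\<close> of the initial set and a superlevel set \<open>Q\<close>;
  \<open>T\<close> is the new filled part and contains the rearranged superlevel set
  \<open>P\<close>. The length \<open>b\<close> of the trace moves into the new enhancement
  \<open>d\<close>.\<close>

lemma section_bound:
  fixes b c d :: real
  assumes "S \<subseteq> B \<union> Q" "B \<in> sets lborel" "Q \<in> sets lborel" "emeasure lborel Q \<le> emeasure lborel P"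
    "P \<subseteq> T" "T \<in> sets lborel" "emeasure lborel B = ennreal b" "c + b \<le> d" "0 \<le> b" "0 \<le> c"
  shows "emeasure lborel S + ennreal c \<le> emeasure lborel T + ennreal d"
proof -
  have "emeasure lborel S \<le> emeasure lborel (B \<union> Q)" using assms by (intro emeasure_mono) auto
  also have "\<dots> \<le> emeasure lborel B + emeasure lborel Q" using assms by (intro emeasure_subadditive)
  also have "\<dots> \<le> ennreal b + emeasure lborel T"
    using assms emeasure_mono[of P T lborel] by (intro add_mono) auto
  finally have "emeasure lborel S + ennreal c \<le> ennreal b + emeasure lborel T + ennreal c"
    by (rule add_right_mono)
  also have "\<dots> = emeasure lborel T + ennreal (c + b)"
    using assms by (simp add: ennreal_plus ac_simps)
  also have "\<dots> \<le> emeasure lborel T + ennreal d" using assms by (intro add_left_mono ennreal_leI)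
  finally show ?thesis .
qed

text \<open>Rows and columns must each be compensated for their sections of \<open>A\<close>, so its
  area is charged once to \<open>F\<close> and once to \<open>G\<close>. This is the source of the
  factor 2 in the final bound.\<close>

lemma espans_enhancement_only:
  assumes Z: "lower_region Z" and A: "compact A" "A \<subseteq> quadrant"
    and f: "admissible_fun f" and g: "admissible_fun g" and sp: "espans Z f g A"
  obtains F G where "admissible_fun F" "admissible_fun G" "espans Z F G {}"
    "integral {0..} F \<le> integral {0..} f + measure lborel A"
    "integral {0..} G \<le> integral {0..} g + measure lborel A"
proof -
  define a where "a v = measure lborel {t. (t, v) \<in> A}" for v
  define b where "b u = measure lborel {t. (u, t) \<in> A}" for u
  have Ab: "A \<in> sets borel" using A(1) by (simp add: borel_compact)
  have cl: "closed Z" using Z by (simp add: lower_region_def)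
  obtain K where K: "\<And>x. x \<in> A \<Longrightarrow> norm x \<le> K"
    using compact_imp_bounded[OF A(1)] by (auto simp: bounded_iff)
  define K' where "K' = max 0 K"
  have AK: "0 \<le> u \<and> u \<le> K' \<and> 0 \<le> v \<and> v \<le> K'" if "(u, v) \<in> A" for u v
  proof -
    have "norm u \<le> K" "norm v \<le> K"
      using K[OF that] norm_fst_le[of u v] norm_snd_le[of v u] by linarith+
    thus ?thesis using that A(2) by (auto simp: quadrant_def K'_def)
  qed
  have sec: "emeasure lborel S = ennreal (measure lborel S) \<and> measure lborel S \<le> K'"
    if "S \<subseteq> {0..K'}" for S :: "real set"
  proof -
    have *: "emeasure lborel S \<le> emeasure lborel {0..K'}" using that by (intro emeasure_mono) auto
    hence "emeasure lborel S < top" by (simp add: order_le_less_trans K'_def)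
    hence "emeasure lborel S = ennreal (measure lborel S)" by (intro emeasure_eq_ennreal_measure) auto
    thus ?thesis using * by (simp add: K'_def)
  qed
  have a_eq: "emeasure lborel {t. (t, v) \<in> A} = ennreal (a v)" and aK: "a v \<le> K'" for v
    unfolding a_def using AK by (auto intro!: sec[THEN conjunct1] sec[THEN conjunct2])
  have b_eq: "emeasure lborel {t. (u, t) \<in> A} = ennreal (b u)" and bK: "b u \<le> K'" for u
    unfolding b_def using AK by (auto intro!: sec[THEN conjunct1] sec[THEN conjunct2])
  have a0: "0 \<le> a v" and b0: "0 \<le> b v" for v by (auto simp: a_def b_def)
  have outside: "{t. (t, v) \<in> A} = {}" "{t. (v, t) \<in> A} = {}" if "K' < v" for v
    using AK that by force+
  have az: "a v = 0" and bz: "b v = 0" if "K' < v" for v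
    unfolding a_def b_def outside[OF that] by (simp_all only: measure_empty)
  have am: "a \<in> borel_measurable borel" and bm: "b \<in> borel_measurable borel"
    using horizontal_length_measurable[OF Ab] vertical_length_measurable[OF Ab]
    by (auto simp: a_def[abs_def] b_def[abs_def] measure_def intro!: measurable_compose[OF _ borel_measurable_enn2real])
  have "emeasure lborel A < \<infinity>" by (rule emeasure_bounded_finite[OF compact_imp_bounded[OF A(1)]])
  hence area: "emeasure lborel A = ennreal (measure lborel A)"
    by (intro emeasure_eq_ennreal_measure) auto
  have ai: "(\<integral>\<^sup>+x. ennreal (a x) \<partial>lborel) = ennreal (measure lborel A)"
    unfolding a_eq[symmetric] area[symmetric] emeasure_eq_horizontal[OF Ab] ..
  have bi: "(\<integral>\<^sup>+x. ennreal (b x) \<partial>lborel) = ennreal (measure lborel A)"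
    unfolding b_eq[symmetric] area[symmetric] emeasure_eq_vertical[OF Ab] ..
  obtain F where F: "admissible_fun F"
    "ennreal (integral {0..} F) \<le> ennreal (integral {0..} f) + ennreal (measure lborel A)"
    "\<And>U. up_closed U \<Longrightarrow> {x. 0 \<le> x \<and> f x + a x \<in> U} \<in> sets borel \<and>
      emeasure lborel {x. 0 \<le> x \<and> f x + a x \<in> U} \<le> emeasure lborel {x. 0 \<le> x \<and> F x \<in> U}"
    using enhanced_rearrangement[OF f am a0 aK az, unfolded ai] by blast
  obtain G where G: "admissible_fun G"
    "ennreal (integral {0..} G) \<le> ennreal (integral {0..} g) + ennreal (measure lborel A)"
    "\<And>U. up_closed U \<Longrightarrow> {x. 0 \<le> x \<and> g x + b x \<in> U} \<in> sets borel \<and>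
      emeasure lborel {x. 0 \<le> x \<and> g x + b x \<in> U} \<le> emeasure lborel {x. 0 \<le> x \<and> G x \<in> U}"
    using enhanced_rearrangement[OF g bm b0 bK bz, unfolded bi] by blast
  let ?T = "\<lambda>n. (eT Z f g ^^ n) A" and ?C = "\<lambda>n. (eT Z F G ^^ n) {}"
  have C: "?C n \<in> sets borel" for n by (rule funpow_eT_measurable[OF _ cl F(1) G(1)]) simp
  have T: "?T n \<subseteq> quadrant" for n by (rule funpow_eT_subset_quadrant[OF A(2)])
  \<comment> \<open>Points with larger enhancements are filled no later, so outside \<open>A\<close> the filled part of a line lies
    in a superlevel set of the enhancement of the crossing lines, and passing to \<open>F\<close> and \<open>G\<close> does not
    shrink the measure of such sets.\<close>
  have key: "(u', v') \<in> ?C n"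
    if "(u, v) \<in> ?T n" "(u, v) \<notin> A" "(u', v') \<in> quadrant" "f v + a v \<le> F v'" "g u + b u \<le> G u'"
    for n u v u' v'
    using that
  proof (induction n arbitrary: u v u' v')
    case (Suc n)
    show ?case
    proof (cases "(u, v) \<in> ?T n")
      case True
      hence "(u', v') \<in> ?C n" using Suc by blast
      thus ?thesis by (simp add: mem_eT)
    next
      case False
      hence uv: "(u, v) \<in> quadrant"
        "\<not> in_zext Z (erow (u, v) (?T n) + ennreal (f v)) (ecol (u, v) (?T n) + ennreal (g u))"
        using Suc.prems(1) by (auto simp: mem_eT)
      have fg0: "0 \<le> f v" "0 \<le> g u" using f g uv(1) by (auto simp: admissible_fun_def quadrant_def)
      \<comment> \<open>Superlevel set generated by the columns that meet row \<open>v\<close> in a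
        filled point outside \<open>A\<close>. If \<open>G x\<close> lies in \<open>U\<close>, some
        such column has enhanced value at most \<open>G x\<close>, and the induction hypothesis
        fills \<open>(x, v')\<close>.\<close>
      define U where "U = {s. \<exists>x\<ge>0. g x + b x \<le> s \<and> (x, v) \<in> ?T n \<and> (x, v) \<notin> A}"
      have U: "up_closed U" unfolding up_closed_def U_def by (blast intro: order_trans)
      have "erow (u, v) (?T n) + ennreal (f v) \<le> erow (u', v') (?C n) + ennreal (F v')"
        unfolding erow_def snd_conv
      proof (rule section_bound)
        show "{t. (t, v) \<in> ?T n} \<subseteq> {t. (t, v) \<in> A} \<union> {x. 0 \<le> x \<and> g x + b x \<in> U}"
          using T[of n] by (auto simp: U_def quadrant_def)
        show "{t. (t, v) \<in> A} \<in> sets lborel" using horizontal_section_measurable[OF Ab] by simp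
        show "{x. 0 \<le> x \<and> g x + b x \<in> U} \<in> sets lborel" using G(3)[OF U] by simp
        show "emeasure lborel {x. 0 \<le> x \<and> g x + b x \<in> U} \<le> emeasure lborel {x. 0 \<le> x \<and> G x \<in> U}"
          using G(3)[OF U] by simp
        show "{t. (t, v') \<in> ?C n} \<in> sets lborel" using horizontal_section_measurable[OF C] by simp
        show "{x. 0 \<le> x \<and> G x \<in> U} \<subseteq> {t. (t, v') \<in> ?C n}"
          using Suc.prems(3,4) by (auto simp: U_def quadrant_def intro!: Suc.IH)
        show "emeasure lborel {t. (t, v) \<in> A} = ennreal (a v)" by (rule a_eq)
      qed (use Suc.prems a0 fg0 in auto)
      moreover
      define W where "W = {s. \<exists>y\<ge>0. f y + a y \<le> s \<and> (u, y) \<in> ?T n \<and> (u, y) \<notin> A}"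
      have W: "up_closed W" unfolding up_closed_def W_def by (blast intro: order_trans)
      have "ecol (u, v) (?T n) + ennreal (g u) \<le> ecol (u', v') (?C n) + ennreal (G u')"
        unfolding ecol_def fst_conv
      proof (rule section_bound)
        show "{t. (u, t) \<in> ?T n} \<subseteq> {t. (u, t) \<in> A} \<union> {x. 0 \<le> x \<and> f x + a x \<in> W}"
          using T[of n] by (auto simp: W_def quadrant_def)
        show "{t. (u, t) \<in> A} \<in> sets lborel" using vertical_section_measurable[OF Ab] by simp
        show "{x. 0 \<le> x \<and> f x + a x \<in> W} \<in> sets lborel" using F(3)[OF W] by simp
        show "emeasure lborel {x. 0 \<le> x \<and> f x + a x \<in> W} \<le> emeasure lborel {x. 0 \<le> x \<and> F x \<in> W}"
          using F(3)[OF W] by simp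
        show "{t. (u', t) \<in> ?C n} \<in> sets lborel" using vertical_section_measurable[OF C] by simp
        show "{x. 0 \<le> x \<and> F x \<in> W} \<subseteq> {t. (u', t) \<in> ?C n}"
          using Suc.prems(3,5) by (auto simp: W_def quadrant_def intro!: Suc.IH)
        show "emeasure lborel {t. (u, t) \<in> A} = ennreal (b u)" by (rule b_eq)
      qed (use Suc.prems b0 fg0 in auto)
      ultimately show ?thesis
        using in_zext_mono[OF Z] uv(2) Suc.prems(3) by (auto simp: mem_eT)
    qed
  qed simp
  obtain Kf where Kf: "\<And>x. Kf \<le> x \<Longrightarrow> f x = 0" using f by (auto simp: admissible_fun_def)
  obtain Kg where Kg: "\<And>x. Kg \<le> x \<Longrightarrow> g x = 0" using g by (auto simp: admissible_fun_def)
  \<comment> \<open>The point \<open>(m, m)\<close> lies beyond \<open>A\<close> and both supports,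
    so its enhanced values are 0, at most every value of \<open>F\<close> and \<open>G\<close>. The
    stage that fills it in the old process therefore fills the whole quadrant in the new
    one.\<close>
  define m where "m = max (K' + 1) (max Kf Kg)"
  have m: "0 \<le> m" "K' < m" "f m = 0" "g m = 0" using Kf Kg by (auto simp: m_def K'_def)
  have "(m, m) \<in> quadrant" using m by (simp add: quadrant_def)
  then obtain n where n: "(m, m) \<in> ?T n" using sp unfolding espans_def by auto
  have "(m, m) \<notin> A" using AK m by force
  have "espans Z F G {}"
  proof (rule espansI)
    fix u v :: real assume uv: "(u, v) \<in> quadrant"
    have "0 \<le> F v" "0 \<le> G u" using uv F(1) G(1) by (auto simp: admissible_fun_def quadrant_def)
    hence "(u, v) \<in> ?C n" using m az bz by (intro key[OF n \<open>(m, m) \<notin> A\<close> uv]) auto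
    thus "\<exists>n. (u, v) \<in> ?C n" by blast
  qed simp
  moreover have "integral {0..} F \<le> integral {0..} f + measure lborel A"
    "integral {0..} G \<le> integral {0..} g + measure lborel A"
    using F(2) G(2) admissible_nn_integral(2)[OF f] admissible_nn_integral(2)[OF g]
    by (simp_all add: ennreal_plus[symmetric] del: ennreal_plus)
  ultimately show thesis using that F(1) G(1) by blast
qed

section \<open>Bounds for the infimum\<close>

text \<open>Named separately because a real infimum is informative only for a nonempty set that is
  bounded below, and both properties are tracked for this set.\<close>

definition spanning_costs :: "real \<Rightarrow> real \<Rightarrow> (real \<times> real) set \<Rightarrow> real set" where
  "spanning_costs \<alpha> \<beta> Z =
    {measure lborel A + (1 - \<alpha>) * integral {0..} f + (1 - \<beta>) * integral {0..} g
      | A f g. compact A \<and> A \<subseteq> quadrant \<and> admissible_fun f \<and> admissible_fun g \<and> espans Z f g A}"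

lemma I_bdd_eq_Inf: "I_bdd \<alpha> \<beta> Z = Inf (spanning_costs \<alpha> \<beta> Z)"
  by (simp add: I_bdd_def spanning_costs_def)

lemma spanning_costsI:
  "compact A \<Longrightarrow> A \<subseteq> quadrant \<Longrightarrow> admissible_fun f \<Longrightarrow> admissible_fun g \<Longrightarrow> espans Z f g A \<Longrightarrow>
    measure lborel A + (1 - \<alpha>) * integral {0..} f + (1 - \<beta>) * integral {0..} g \<in> spanning_costs \<alpha> \<beta> Z"
  unfolding spanning_costs_def by blast

lemma spanning_costsE:
  assumes "x \<in> spanning_costs \<alpha> \<beta> Z"
  obtains A f g where "compact A" "A \<subseteq> quadrant" "admissible_fun f" "admissible_fun g" "espans Z f g A"
    "x = measure lborel A + (1 - \<alpha>) * integral {0..} f + (1 - \<beta>) * integral {0..} g"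
  using assms unfolding spanning_costs_def by blast

lemma bdd_below_spanning_costs:
  assumes "\<alpha> \<le> 1" "\<beta> \<le> 1"
  shows "bdd_below (spanning_costs \<alpha> \<beta> Z)"
proof (rule bdd_belowI[of _ 0])
  fix x assume "x \<in> spanning_costs \<alpha> \<beta> Z"
  then obtain A f g where "compact A" "A \<subseteq> quadrant" and *: "admissible_fun f" "admissible_fun g" and "espans Z f g A"
    and x: "x = measure lborel A + (1 - \<alpha>) * integral {0..} f + (1 - \<beta>) * integral {0..} g"
    by (rule spanning_costsE)
  show "0 \<le> x" unfolding x using assms admissible_nn_integral(2)[OF *(1)] admissible_nn_integral(2)[OF *(2)] by simp
qed

lemma I_bdd_le:
  assumes "\<alpha> \<le> 1" "\<beta> \<le> 1" "compact A" "A \<subseteq> quadrant" "admissible_fun f" "admissible_fun g" "espans Z f g A"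
  shows "I_bdd \<alpha> \<beta> Z \<le> measure lborel A + (1 - \<alpha>) * integral {0..} f + (1 - \<beta>) * integral {0..} g"
  unfolding I_bdd_eq_Inf using assms by (intro cInf_lower spanning_costsI bdd_below_spanning_costs)

lemma bounded_region_enhancement_integral:
  assumes "lower_region Z" "Z \<subseteq> erect R R" "0 \<le> R" "0 < e"
  obtains f where "admissible_fun f" "espans Z f (\<lambda>_. 0) {}"
    "integral {0..} f \<le> measure lborel Z + e * (2 * R + e)"
proof -
  obtain f where f: "admissible_fun f" "espans Z f (\<lambda>_. 0) {}"
    "(\<integral>\<^sup>+x\<in>{0..}. ennreal (f x) \<partial>lborel) \<le> emeasure lborel Z + ennreal (e * (2 * R + e))"
    by (rule bounded_region_enhancement[OF assms])
  have "bounded Z" using assms(2) by (rule bounded_subset[rotated]) (simp add: erect_def bounded_Times)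
  hence "emeasure lborel Z = ennreal (measure lborel Z)"
    using emeasure_bounded_finite by (intro emeasure_eq_ennreal_measure) fastforce
  hence "ennreal (integral {0..} f) \<le> ennreal (measure lborel Z + e * (2 * R + e))"
    using f assms by (simp add: admissible_nn_integral(1) ennreal_plus)
  hence "integral {0..} f \<le> measure lborel Z + e * (2 * R + e)"
    using assms by (subst (asm) ennreal_le_iff) auto
  thus thesis using that f by blast
qed

lemma lower_region_swap: "lower_region Z \<Longrightarrow> lower_region (prod.swap ` Z)"
proof -
  assume Z: "lower_region Z"
  have eq: "prod.swap ` Z = prod.swap -` Z" by (auto simp: mem_swap_image)
  have "closed (prod.swap ` Z)"
    unfolding eq using Z by (intro closed_vimage continuous_intros) (auto simp: lower_region_def)
  thus ?thesis
    using Z by (force simp: lower_region_def erect_def quadrant_def)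
qed

text \<open>The rows of \<open>A\<close> are the columns of its swap, so Fubini in the two orders
  yields the same integral.\<close>

lemma measure_swap:
  assumes "A \<in> sets (borel :: (real \<times> real) measure)" "prod.swap ` A \<in> sets borel"
  shows "measure lborel (prod.swap ` A) = measure lborel A"
  unfolding measure_def emeasure_eq_horizontal[OF assms(1)] emeasure_eq_vertical[OF assms(2)]
  by (simp add: mem_swap_image)

lemma spanning_costs_nonempty:
  assumes "lower_region Z" "Z \<subseteq> erect R R" "0 \<le> R"
  shows "spanning_costs \<alpha> \<beta> Z \<noteq> {}"
proof -
  obtain f where "admissible_fun f" "espans Z f (\<lambda>_. 0) {}"
    by (rule bounded_region_enhancement_integral[OF assms zero_less_one])
  from spanning_costsI[OF _ _ this(1) admissible_fun_zero this(2)] show ?thesis by auto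
qed

text \<open>Let \<open>e\<close> tend to 0 from the right. Keeping the factor \<open>c\<close> in
  place covers \<open>c = 0\<close> without a division.\<close>

lemma le_of_le_quadratic_error:
  fixes a b R c :: real
  assumes "\<And>e. 0 < e \<Longrightarrow> a \<le> c * (b + e * (2 * R + e))"
  shows "a \<le> c * b"
proof -
  have "((\<lambda>e. c * (b + e * (2 * R + e))) \<longlongrightarrow> c * (b + 0 * (2 * R + 0))) (at_right 0)"
    by (intro tendsto_intros)
  moreover have "eventually (\<lambda>e. a \<le> c * (b + e * (2 * R + e))) (at_right 0)"
    using eventually_at_right_less[of 0] by eventually_elim (rule assms)
  ultimately have "a \<le> c * (b + 0 * (2 * R + 0))"
    by (intro tendsto_lowerbound) auto
  thus ?thesis by simp
qed

lemma I_bdd_le_area: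
  assumes Z: "lower_region Z" "Z \<subseteq> erect R R" "0 \<le> R" and ab: "\<alpha> \<le> 1" "\<beta> \<le> 1"
  shows "I_bdd \<alpha> \<beta> Z \<le> (1 - max \<alpha> \<beta>) * measure lborel Z"
proof -
  have "I_bdd \<alpha> \<beta> Z \<le> (1 - \<alpha>) * measure lborel Z"
  proof (rule le_of_le_quadratic_error)
    fix e :: real assume "0 < e"
    then obtain f where f: "admissible_fun f" "espans Z f (\<lambda>_. 0) {}"
      "integral {0..} f \<le> measure lborel Z + e * (2 * R + e)"
      by (rule bounded_region_enhancement_integral[OF Z])
    have "I_bdd \<alpha> \<beta> Z \<le> (1 - \<alpha>) * integral {0..} f"
      using I_bdd_le[OF ab _ _ f(1) admissible_fun_zero f(2)] by simp
    also have "\<dots> \<le> (1 - \<alpha>) * (measure lborel Z + e * (2 * R + e))"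
      using f ab by (intro mult_left_mono) auto
    finally show "I_bdd \<alpha> \<beta> Z \<le> (1 - \<alpha>) * (measure lborel Z + e * (2 * R + e))" .
  qed
  \<comment> \<open>In swapped coordinates the same construction applies; back in the original ones
    the strips are vertical, \<open>f\<close> is 0 and only \<open>g\<close> is paid for.\<close>
  moreover have "I_bdd \<alpha> \<beta> Z \<le> (1 - \<beta>) * measure lborel Z"
  proof (rule le_of_le_quadratic_error)
    let ?Z = "prod.swap ` Z"
    have swap_sub: "?Z \<subseteq> erect R R" using Z(2) by (auto simp: erect_def)
    have "Z \<in> sets borel" "?Z \<in> sets borel"
      using Z(1) lower_region_swap[OF Z(1)] by (auto simp: lower_region_def intro: borel_closed)
    hence area: "measure lborel ?Z = measure lborel Z" by (rule measure_swap)
    fix e :: real assume "0 < e"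
    then obtain g where g: "admissible_fun g" "espans ?Z g (\<lambda>_. 0) {}"
      "integral {0..} g \<le> measure lborel ?Z + e * (2 * R + e)"
      by (rule bounded_region_enhancement_integral[OF lower_region_swap[OF Z(1)] swap_sub Z(3)])
    have "espans Z (\<lambda>_. 0) g {}" using espans_swap[OF g(2)] by (simp add: image_image)
    hence "I_bdd \<alpha> \<beta> Z \<le> (1 - \<beta>) * integral {0..} g"
      using I_bdd_le[OF ab _ _ admissible_fun_zero g(1), of "{}" Z] by simp
    also have "\<dots> \<le> (1 - \<beta>) * (measure lborel Z + e * (2 * R + e))"
      using g ab area by (intro mult_left_mono) auto
    finally show "I_bdd \<alpha> \<beta> Z \<le> (1 - \<beta>) * (measure lborel Z + e * (2 * R + e))" .
  qed
  ultimately show ?thesis by (simp add: max_def)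
qed

text \<open>The weights \<open>1\<close>, \<open>1 - \<alpha>\<close> and \<open>1 - \<beta>\<close>
  are all at least \<open>1 - max \<alpha> \<beta>\<close>, so the inequality already holds for each
  spanning triple.\<close>

lemma I_bdd_ge:
  assumes "spanning_costs \<alpha> \<beta> Z \<noteq> {}" "0 \<le> \<alpha>" "\<alpha> \<le> 1" "0 \<le> \<beta>" "\<beta> \<le> 1"
  shows "(1 - max \<alpha> \<beta>) * I_bdd 0 0 Z \<le> I_bdd \<alpha> \<beta> Z"
  unfolding I_bdd_eq_Inf[of \<alpha> \<beta>]
proof (rule cInf_greatest[OF assms(1)])
  fix x assume "x \<in> spanning_costs \<alpha> \<beta> Z"
  then obtain A f g where *: "compact A" "A \<subseteq> quadrant" "admissible_fun f" "admissible_fun g" "espans Z f g A"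
    and x: "x = measure lborel A + (1 - \<alpha>) * integral {0..} f + (1 - \<beta>) * integral {0..} g"
    by (rule spanning_costsE)
  let ?m = "1 - max \<alpha> \<beta>"
  have "?m * I_bdd 0 0 Z \<le> ?m * (measure lborel A + integral {0..} f + integral {0..} g)"
    using I_bdd_le[OF _ _ *, of 0 0] assms by (intro mult_left_mono) auto
  also have "\<dots> = ?m * measure lborel A + ?m * integral {0..} f + ?m * integral {0..} g"
    by (simp add: algebra_simps)
  also have "\<dots> \<le> 1 * measure lborel A + (1 - \<alpha>) * integral {0..} f + (1 - \<beta>) * integral {0..} g"
    using assms admissible_nn_integral(2)[OF *(3)] admissible_nn_integral(2)[OF *(4)]
    by (intro add_mono mult_right_mono) auto
  finally show "?m * I_bdd 0 0 Z \<le> x" by (simp add: x)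
qed

lemma I_bdd_le_gamma:
  assumes "spanning_costs 0 0 Z \<noteq> {}" "0 \<le> \<alpha>" "\<alpha> \<le> 1" "0 \<le> \<beta>" "\<beta> \<le> 1"
  shows "I_bdd \<alpha> \<beta> Z \<le> I_bdd 0 0 Z"
  unfolding I_bdd_eq_Inf[of 0 0]
proof (rule cInf_greatest[OF assms(1)])
  fix x assume "x \<in> spanning_costs 0 0 Z"
  then obtain A f g where *: "compact A" "A \<subseteq> quadrant" "admissible_fun f" "admissible_fun g" "espans Z f g A"
    and x: "x = measure lborel A + (1 - 0) * integral {0..} f + (1 - 0) * integral {0..} g"
    by (rule spanning_costsE)
  have "I_bdd \<alpha> \<beta> Z \<le> measure lborel A + (1 - \<alpha>) * integral {0..} f + (1 - \<beta>) * integral {0..} g"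
    by (rule I_bdd_le[OF assms(3,5) *])
  also have "\<dots> \<le> x"
    unfolding x using assms admissible_nn_integral(2)[OF *(3)] admissible_nn_integral(2)[OF *(4)]
    by (intro add_mono mult_right_mono) auto
  finally show "I_bdd \<alpha> \<beta> Z \<le> x" .
qed

lemma I_bdd_le_twice_gamma:
  assumes Z: "lower_region Z" and ne: "spanning_costs 0 0 Z \<noteq> {}" and ab: "\<alpha> \<le> 1" "\<beta> \<le> 1"
  shows "I_bdd \<alpha> \<beta> Z \<le> 2 * (1 - min \<alpha> \<beta>) * I_bdd 0 0 Z"
proof -
  let ?c = "2 * (1 - min \<alpha> \<beta>)"
  have le: "I_bdd \<alpha> \<beta> Z \<le> ?c * x" if x_in: "x \<in> spanning_costs 0 0 Z" for x
  proof -
    obtain A f g where *: "compact A" "A \<subseteq> quadrant" "admissible_fun f" "admissible_fun g" "espans Z f g A"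
      and x: "x = measure lborel A + (1 - 0) * integral {0..} f + (1 - 0) * integral {0..} g"
      using x_in by (rule spanning_costsE)
    obtain F G where FG: "admissible_fun F" "admissible_fun G" "espans Z F G {}"
      "integral {0..} F \<le> integral {0..} f + measure lborel A"
      "integral {0..} G \<le> integral {0..} g + measure lborel A"
      by (rule espans_enhancement_only[OF Z *])
    note nonneg = admissible_nn_integral(2)[OF *(3)] admissible_nn_integral(2)[OF *(4)]
      admissible_nn_integral(2)[OF FG(1)] admissible_nn_integral(2)[OF FG(2)]
    have "I_bdd \<alpha> \<beta> Z \<le> (1 - \<alpha>) * integral {0..} F + (1 - \<beta>) * integral {0..} G"
      using I_bdd_le[OF ab _ _ FG(1-3)] by simp
    also have "\<dots> \<le> (1 - min \<alpha> \<beta>) * integral {0..} F + (1 - min \<alpha> \<beta>) * integral {0..} G"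
      using nonneg by (intro add_mono mult_right_mono) auto
    also have "\<dots> = (1 - min \<alpha> \<beta>) * (integral {0..} F + integral {0..} G)"
      by (simp add: algebra_simps)
    \<comment> \<open>Together \<open>F\<close> and \<open>G\<close> cost at most as much as
      \<open>f\<close> and \<open>g\<close> plus twice the area of \<open>A\<close>, hence at most
      \<open>2 * x\<close>.\<close>
    also have "\<dots> \<le> (1 - min \<alpha> \<beta>) * (2 * x)"
      using FG(4,5) nonneg ab by (intro mult_left_mono) (auto simp: x)
    finally show ?thesis by (simp add: algebra_simps)
  qed
  \<comment> \<open>Moving the constant out of the infimum means dividing by it; when it is 0, any
    single member gives the bound.\<close>
  consider "?c = 0" | "0 < ?c" using ab by fastforce
  thus ?thesis
  proof cases
    case 1
    then show ?thesis using ne le by fastforce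
  next
    case 2
    have "I_bdd \<alpha> \<beta> Z / ?c \<le> I_bdd 0 0 Z"
      unfolding I_bdd_eq_Inf[of 0 0]
    proof (rule cInf_greatest[OF ne])
      show "I_bdd \<alpha> \<beta> Z / ?c \<le> x" if "x \<in> spanning_costs 0 0 Z" for x
        using le[OF that] 2 by (subst pos_divide_le_eq) (auto simp: mult.commute)
    qed
    thus ?thesis using 2 by (subst (asm) pos_divide_le_eq) (auto simp: mult.commute)
  qed
qed

section \<open>Monotonicity in the zero-set and passage to the limit\<close>

lemma I_bdd_mono:
  assumes "lower_region Z" "Z \<subseteq> Z'" "spanning_costs \<alpha> \<beta> Z' \<noteq> {}" "\<alpha> \<le> 1" "\<beta> \<le> 1"
  shows "I_bdd \<alpha> \<beta> Z \<le> I_bdd \<alpha> \<beta> Z'"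
  unfolding I_bdd_eq_Inf
proof (rule cInf_superset_mono[OF assms(3) bdd_below_spanning_costs[OF assms(4,5)]])
  show "spanning_costs \<alpha> \<beta> Z' \<subseteq> spanning_costs \<alpha> \<beta> Z"
  proof
    fix x assume "x \<in> spanning_costs \<alpha> \<beta> Z'"
    then obtain A f g where *: "compact A" "A \<subseteq> quadrant" "admissible_fun f" "admissible_fun g" "espans Z' f g A"
      and x: "x = measure lborel A + (1 - \<alpha>) * integral {0..} f + (1 - \<beta>) * integral {0..} g"
      by (rule spanning_costsE)
    have "espans Z f g A"
      by (rule espans_antimono[OF assms(1,2) _ *(2-5)]) (simp add: *(1) borel_compact)
    thus "x \<in> spanning_costs \<alpha> \<beta> Z" unfolding x by (intro spanning_costsI *)
  qed
qed

text \<open>\<open>Lim\<close> carries information only when a limit exists; here the supremum of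
  the range is one.\<close>

lemma mono_bounded_tendsto_Lim:
  fixes h :: "real \<Rightarrow> real"
  assumes "mono h" "\<And>R. h R \<le> B"
  shows "(h \<longlongrightarrow> Lim at_top h) at_top"
proof -
  have bdd: "bdd_above (range h)" using assms(2) by (auto intro: bdd_aboveI[of _ B])
  have "(h \<longlongrightarrow> (SUP R. h R)) at_top"
  proof (rule order_tendstoI)
    fix a assume "a < (SUP R. h R)"
    then obtain R where "a < h R" using less_cSUP_iff[OF _ bdd] by auto
    thus "eventually (\<lambda>R. a < h R) at_top"
      using monoD[OF assms(1)] by (intro eventually_at_top_linorderI[of R]) (auto intro: less_le_trans)
  next
    fix a assume "(SUP R. h R) < a"
    thus "eventually (\<lambda>R. h R < a) at_top"
      using cSUP_upper[OF _ bdd] by (intro always_eventually) (auto intro: le_less_trans)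
  qed
  thus ?thesis using tendsto_Lim[OF trivial_limit_at_top_linorder] by metis
qed

theorem mainTheorem5:
  fixes Z :: "(real \<times> real) set" and \<alpha> \<beta> :: real
  assumes "ezero_set Z"
    and "emeasure lborel Z < \<infinity>"
    and "\<alpha> \<in> {0..1}" and "\<beta> \<in> {0..1}"
  shows "I_tilde \<alpha> \<beta> Z \<ge> (1 - max \<alpha> \<beta>) * gamma_tilde Z
     \<and> I_tilde \<alpha> \<beta> Z \<le> min (min ((1 - max \<alpha> \<beta>) * measure lborel Z)
                              (2 * (1 - min \<alpha> \<beta>) * gamma_tilde Z))
                         (gamma_tilde Z)"
proof -
  define Q where "Q R = Z \<inter> erect R R" for R
  have Z: "lower_region Z" using assms(1) by (auto simp: ezero_set_def lower_region_def)
  have Q: "lower_region (Q R)" for R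
    unfolding lower_region_def
  proof (intro conjI allI impI)
    show "closed (Q R)"
      using Z by (auto simp: Q_def lower_region_def erect_def intro!: closed_Int closed_Times)
    show "Q R \<subseteq> quadrant" using Z by (auto simp: Q_def lower_region_def)
    fix a b assume "(a, b) \<in> Q R"
    thus "erect a b \<subseteq> Q R" using Z by (fastforce simp: Q_def lower_region_def erect_def)
  qed
  \<comment> \<open>For negative \<open>R\<close> the truncation is empty, so \<open>max 0 R\<close>
    serves as a nonnegative side length for all \<open>R\<close>.\<close>
  have Q_sub: "Q R \<subseteq> erect (max 0 R) (max 0 R)" for R by (auto simp: Q_def erect_def)
  have Q_mono: "Q R \<subseteq> Q R'" if "R \<le> R'" for R R' using that by (auto simp: Q_def erect_def)
  have ne: "spanning_costs a b (Q R) \<noteq> {}" for a b R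
    by (rule spanning_costs_nonempty[OF Q Q_sub]) simp
  have Zb: "Z \<in> sets borel" using Z by (simp add: lower_region_def borel_closed)
  \<comment> \<open>Finite area enters here: \<open>measure\<close> is 0 on sets of infinite
    measure. The resulting bound is uniform in \<open>R\<close>.\<close>
  have area: "measure lborel (Q R) \<le> measure lborel Z" for R
    using assms(2) Q[of R] Zb
    by (intro measure_mono_fmeasurable) (auto simp: Q_def fmeasurable_def lower_region_def intro: borel_closed)
  have le_area: "I_bdd a b (Q R) \<le> (1 - max a b) * measure lborel Z" if "a \<le> 1" "b \<le> 1" for a b R
  proof -
    have "I_bdd a b (Q R) \<le> (1 - max a b) * measure lborel (Q R)"
      by (rule I_bdd_le_area[OF Q Q_sub _ that]) simp
    also have "\<dots> \<le> (1 - max a b) * measure lborel Z" using that area by (intro mult_left_mono) auto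
    finally show ?thesis .
  qed
  \<comment> \<open>The truncated infima increase with \<open>R\<close> and stay below the area
    bound, so \<open>I_tilde\<close> is a genuine limit and weak inequalities pass to it.\<close>
  have lim: "((\<lambda>R. I_bdd a b (Q R)) \<longlongrightarrow> I_tilde a b Z) at_top" if "a \<le> 1" "b \<le> 1" for a b
    unfolding I_tilde_def Q_def[symmetric]
    by (rule mono_bounded_tendsto_Lim[OF monoI le_area[OF that]]) (rule I_bdd_mono[OF Q Q_mono ne that])
  have ab: "0 \<le> \<alpha>" "\<alpha> \<le> 1" "0 \<le> \<beta>" "\<beta> \<le> 1" using assms by auto
  note lim_ab = lim[OF ab(2,4)]
  have lim_00: "((\<lambda>R. I_bdd 0 0 (Q R)) \<longlongrightarrow> gamma_tilde Z) at_top"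
    unfolding gamma_tilde_def by (rule lim) auto
  have "(1 - max \<alpha> \<beta>) * gamma_tilde Z \<le> I_tilde \<alpha> \<beta> Z"
    by (rule tendsto_le[OF _ lim_ab tendsto_mult_left[OF lim_00]])
       (auto intro!: always_eventually I_bdd_ge ne ab)
  moreover have "I_tilde \<alpha> \<beta> Z \<le> (1 - max \<alpha> \<beta>) * measure lborel Z"
    by (rule tendsto_upperbound[OF lim_ab]) (auto intro!: always_eventually le_area ab)
  moreover have "I_tilde \<alpha> \<beta> Z \<le> 2 * (1 - min \<alpha> \<beta>) * gamma_tilde Z"
    by (rule tendsto_le[OF _ tendsto_mult_left[OF lim_00] lim_ab])
       (simp, intro always_eventually allI I_bdd_le_twice_gamma[OF Q ne ab(2,4)])
  moreover have "I_tilde \<alpha> \<beta> Z \<le> gamma_tilde Z"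
    by (rule tendsto_le[OF _ lim_00 lim_ab]) (auto intro!: always_eventually I_bdd_le_gamma ne ab)
  ultimately show ?thesis by simp
qed

end
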